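(* For any $\theta\in[-1,1]$, a 2D symmetric OCAD on $\Omega=[-1,1]^2$, both for $\mathbb P^2$ and for $\mathbb P^3$, is given by $$\langle p\rangle_\Omega=\overline\omega_\star\big[(1+\theta)\langle p\rangle_\Omega^x+(1-\theta)\langle p\rangle_\Omega^y\big]+\omega_1\,\overline{p(x^{(1)},y^{(1)})}$$ with $$\overline\omega_\star=\frac1{4+2|\theta|},\qquad \omega_1=\frac{1+|\theta|}{2+|\theta|},\qquad (x^{(1)},y^{(1)})=\begin{cases}\Big(\sqrt{\tfrac{2|\theta|}{3+3|\theta|}},\,0\Big)&\text{if }\theta\in[-1,0],\\[4pt]\Big(0,\,\sqrt{\tfrac{2|\theta|}{3+3|\theta|}}\Big)&\text{if }\theta\in[0,1].\end{cases}$$ Moreover, for all $\theta\in[-1,1]$ and $k\in\{2,3\}$, $$\overline\omega_\star(\theta,\mathbb P^k)=\phi^\star(\theta,\mathbb P^k_+)=\phi^\star(\theta,(\mathbb P^1)^2)=\frac1{4+2|\theta|},$$ and there exists a critical positive polynomial for $\phi^\star(\theta,\mathbb P^k_+)$ of the form $q_\star^2$ with $q_\star\in\mathbb P^1\setminus\{0\}$.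
   Context: $\mathbb P^k$: real polynomials in $(x,y)$ of total degree at most $k$. $\langle p\rangle_\Omega=\frac14\iint_\Omega p$, $\langle p\rangle_\Omega^x=\frac14\int_{-1}^1[p(-1,y)+p(1,y)]dy$, $\langle p\rangle_\Omega^y=\frac14\int_{-1}^1[p(x,-1)+p(x,1)]dx$, $\overline{p(a,b)}=\frac14[p(a,b)+p(-a,b)+p(a,-b)+p(-a,-b)]$. A feasible symmetric CAD for $(\theta,\mathbb P^k)$ with boundary weight $\overline\omega$ is an identity $\langle p\rangle_\Omega=\overline\omega[(1+\theta)\langle p\rangle_\Omega^x+(1-\theta)\langle p\rangle_\Omega^y]+\sum_{s=1}^S\omega_s\overline{p(x^{(s)},y^{(s)})}$ valid for all $p\in\mathbb P^k$, with $S\ge0$ finite, $\overline\omega>0$, all $\omega_s>0$, all $(x^{(s)},y^{(s)})\in[0,1]^2$. $\overline\omega_\star(\theta,\mathbb P^k)$ is the maximum of $\overline\omega$ over all such CADs, and a symmetric OCAD is one attaining it. $\mathbb P^k_+=\{p\in\mathbb P^k:p\ge0\text{ on }\Omega\}$. For $p\in\mathbb P_+^k$, $\phi(p;\theta)=\dfrac{\langle p\rangle_\Omega}{(1+\theta)\langle p\rangle_\Omega^x+(1-\theta)\langle p\rangle_\Omega^y}$ if the denominator is nonzero, $+\infty$ otherwise; $\phi^\star(\theta,\mathbb P^k_+)=\inf_{p\in\mathbb P^k_+}\phi(p;\theta)$ and $\phi^\star(\theta,(\mathbb P^m)^2)=\inf_{q\in\mathbb P^m}\phi(q^2;\theta)$.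 A critical positive polynomial for $\phi^\star(\theta,\mathbb P^k_+)$ is a $p^\star\in\mathbb P^k_+\setminus\{0\}$ with $\phi(p^\star;\theta)=\phi^\star(\theta,\mathbb P^k_+)$. *)

theory Defs
  imports "HOL-Analysis.Analysis"
begin

(* Bivariate real polynomials are represented by the functions they induce on the plane;
   as the field of reals is infinite, this loses no information. *)
definition polys :: "nat \<Rightarrow> (real \<times> real \<Rightarrow> real) set" where
  "polys k = {p. \<exists>c :: nat \<Rightarrow> nat \<Rightarrow> real.
     \<forall>x y. p (x, y) = (\<Sum>(i, j)\<in>{(i, j). i + j \<le> k}. c i j * x ^ i * y ^ j)}"

definition Omega :: "(real \<times> real) set" where
  "Omega = {-1..1} \<times> {-1..1}"

definition mean :: "(real \<times> real \<Rightarrow> real) \<Rightarrow> real" where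
  "mean p = 1 / 4 * integral Omega p"

definition mean_x :: "(real \<times> real \<Rightarrow> real) \<Rightarrow> real" where
  "mean_x p = 1 / 4 * integral {-1..1} (\<lambda>y. p (-1, y) + p (1, y))"

definition mean_y :: "(real \<times> real \<Rightarrow> real) \<Rightarrow> real" where
  "mean_y p = 1 / 4 * integral {-1..1} (\<lambda>x. p (x, -1) + p (x, 1))"

definition boundary_mean :: "real \<Rightarrow> (real \<times> real \<Rightarrow> real) \<Rightarrow> real" where
  "boundary_mean \<theta> p = (1 + \<theta>) * mean_x p + (1 - \<theta>) * mean_y p"

definition sym_avg :: "(real \<times> real \<Rightarrow> real) \<Rightarrow> real \<times> real \<Rightarrow> real" where
  "sym_avg p = (\<lambda>(a, b). 1 / 4 * (p (a, b) + p (-a, b) + p (a, -b) + p (-a, -b)))"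

(* The boundary weight is wb; the S internal nodes z 1, ..., z S have weights w 1, ..., w S.
   Values of w and z at other indices are irrelevant. *)
definition feasible_symmetric_cad ::
  "real \<Rightarrow> nat \<Rightarrow> real \<Rightarrow> nat \<Rightarrow> (nat \<Rightarrow> real) \<Rightarrow> (nat \<Rightarrow> real \<times> real) \<Rightarrow> bool" where
  "feasible_symmetric_cad \<theta> k wb S w z \<longleftrightarrow>
     wb > 0 \<and> (\<forall>s\<in>{1..S}. w s > 0) \<and> (\<forall>s\<in>{1..S}. z s \<in> {0..1} \<times> {0..1}) \<and>
     (\<forall>p\<in>polys k. mean p = wb * boundary_mean \<theta> p + (\<Sum>s=1..S. w s * sym_avg p (z s)))"

definition omega_star :: "real \<Rightarrow> nat \<Rightarrow> real" where
  "omega_star \<theta> k = (GREATEST wb. \<exists>S w z. feasible_symmetric_cad \<theta> k wb S w z)"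

(* Optimality is stated directly as maximality of the boundary weight, so that it
   does not depend on omega_star being well defined. *)
definition symmetric_ocad ::
  "real \<Rightarrow> nat \<Rightarrow> real \<Rightarrow> nat \<Rightarrow> (nat \<Rightarrow> real) \<Rightarrow> (nat \<Rightarrow> real \<times> real) \<Rightarrow> bool" where
  "symmetric_ocad \<theta> k wb S w z \<longleftrightarrow>
     feasible_symmetric_cad \<theta> k wb S w z \<and>
     (\<forall>wb' S' w' z'. feasible_symmetric_cad \<theta> k wb' S' w' z' \<longrightarrow> wb' \<le> wb)"

definition nonneg_polys :: "nat \<Rightarrow> (real \<times> real \<Rightarrow> real) set" where
  "nonneg_polys k = {p \<in> polys k. \<forall>v\<in>Omega. p v \<ge> 0}"

definition square_polys :: "nat \<Rightarrow> (real \<times> real \<Rightarrow> real) set" where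
  "square_polys m = (\<lambda>q v. (q v)\<^sup>2) ` polys m"

definition phi :: "real \<Rightarrow> (real \<times> real \<Rightarrow> real) \<Rightarrow> ereal" where
  "phi \<theta> p = (if boundary_mean \<theta> p \<noteq> 0 then ereal (mean p / boundary_mean \<theta> p) else \<infinity>)"

definition phi_star :: "real \<Rightarrow> (real \<times> real \<Rightarrow> real) set \<Rightarrow> ereal" where
  "phi_star \<theta> A = (INF p\<in>A. phi \<theta> p)"

definition critical_positive_poly :: "real \<Rightarrow> nat \<Rightarrow> (real \<times> real \<Rightarrow> real) \<Rightarrow> bool" where
  "critical_positive_poly \<theta> k p \<longleftrightarrow>
     p \<in> nonneg_polys k - {\<lambda>_. 0} \<and> phi \<theta> p = phi_star \<theta> (nonneg_polys k)"

end

theory Submission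
  imports Defs
begin

text \<open>
  A CAD with boundary weight \<open>wb\<close> gives \<open>mean p \<ge> wb * boundary_mean \<theta> p\<close> for every nonnegative
  \<open>p\<close>, so \<open>wb\<close> is a lower bound of the quotients. For \<open>\<theta> \<ge> 0\<close> the polynomial \<open>x\<^sup>2\<close> has quotient
  exactly \<open>1 / (4 + 2 * \<bar>\<theta>\<bar>)\<close>, and it vanishes at the node \<open>(0, sqrt \<dots>)\<close>; for \<open>\<theta> \<le> 0\<close> one takes
  \<open>y\<^sup>2\<close>. Feasibility is checked on monomials, where by parity only \<open>1\<close>, \<open>x\<^sup>2\<close> and \<open>y\<^sup>2\<close> matter.
\<close>

section \<open>One-variable moments, and polynomials as finite coefficient sums\<close>

definition deg_le :: "nat \<Rightarrow> (nat \<times> nat) set" where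
  "deg_le k = {(i, j). i + j \<le> k}"

definition moment :: "nat \<Rightarrow> real" where
  "moment i = integral {-1..1} (\<lambda>x. x ^ i)"

text \<open>One formula for both parities: the value is 0 for odd \<open>i\<close> and
  \<open>2 / Suc i\<close> for even \<open>i\<close>.\<close>

lemma moment_eq: "moment i = (1 - (-1) ^ Suc i) / Suc i"
proof -
  have "((\<lambda>x. x ^ Suc i / Suc i) has_real_derivative x ^ i) (at x within {-1..1})" for x :: real
    using DERIV_cdivide [OF DERIV_pow [of "Suc i" x], of "Suc i"] by (simp del: of_nat_Suc)
  then have "((\<lambda>x. x ^ i) has_integral (1 ^ Suc i / Suc i - (-1) ^ Suc i / Suc i)) {-1..1::real}"
    by (intro fundamental_theorem_of_calculus)
       (simp_all add: has_real_derivative_iff_has_vector_derivative [symmetric])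
  then show ?thesis
    by (simp add: moment_def integral_unique add_divide_distrib)
qed

lemma finite_deg_le [simp]: "finite (deg_le k)"
  by (rule finite_subset [of _ "{..k} \<times> {..k}"]) (auto simp: deg_le_def)

text \<open>Turns membership into an equation between functions, in the shape on which
  \<open>mean\<close>, \<open>mean_x\<close>, \<open>mean_y\<close> and \<open>sym_avg\<close> are
  evaluated below, so that \<open>p\<close> can be replaced by rewriting.\<close>

lemma polysE:
  assumes "p \<in> polys k"
  obtains c where "p = (\<lambda>v. \<Sum>(i, j)\<in>deg_le k. c i j * fst v ^ i * snd v ^ j)"
proof -
  obtain c where "\<forall>x y. p (x, y) = (\<Sum>(i, j)\<in>deg_le k. c i j * x ^ i * y ^ j)"
    using assms by (auto simp: polys_def deg_le_def)
  then have "p = (\<lambda>v. \<Sum>(i, j)\<in>deg_le k. c i j * fst v ^ i * snd v ^ j)"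
    by auto
  with that show thesis by blast
qed

lemma monomial_in_polys:
  assumes "i + j \<le> k"
  shows "(\<lambda>v. a * fst v ^ i * snd v ^ j) \<in> polys k"
proof -
  have ij: "(i, j) \<in> deg_le k"
    using assms by (simp add: deg_le_def)
  have "(\<Sum>(m, n)\<in>deg_le k. (if (m, n) = (i, j) then a else 0) * x ^ m * y ^ n)
          = a * x ^ i * y ^ j" for x y
  proof -
    have "(\<Sum>(m, n)\<in>deg_le k. (if (m, n) = (i, j) then a else 0) * x ^ m * y ^ n)
        = (\<Sum>u\<in>deg_le k. if u = (i, j) then a * x ^ i * y ^ j else 0)"
      by (intro sum.cong) (auto split: if_splits)
    also have "\<dots> = a * x ^ i * y ^ j"
      using ij by simp
    finally show ?thesis .
  qed
  then show ?thesis unfolding polys_def deg_le_def [symmetric]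
    by (intro CollectI exI [of _ "\<lambda>m n. if (m, n) = (i, j) then a else 0"]) simp
qed

lemma polys_add:
  assumes "p \<in> polys k" "q \<in> polys k"
  shows "(\<lambda>v. p v + q v) \<in> polys k"
proof -
  obtain c where c: "p = (\<lambda>v. \<Sum>(i, j)\<in>deg_le k. c i j * fst v ^ i * snd v ^ j)"
    using assms(1) by (rule polysE)
  obtain d where d: "q = (\<lambda>v. \<Sum>(i, j)\<in>deg_le k. d i j * fst v ^ i * snd v ^ j)"
    using assms(2) by (rule polysE)
  show ?thesis unfolding polys_def deg_le_def [symmetric]
    by (intro CollectI exI [of _ "\<lambda>i j. c i j + d i j"])
       (simp add: c d case_prod_unfold ring_distribs sum.distrib)
qed

lemma deg_le_1: "deg_le (Suc 0) = {(0, 0), (1, 0), (0, 1)}"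
  by (auto simp: deg_le_def)

lemma square_polys_1_subset:
  assumes "2 \<le> k"
  shows "square_polys 1 \<subseteq> polys k"
proof
  fix r assume "r \<in> square_polys 1"
  then obtain q where q: "q \<in> polys 1" and r: "r = (\<lambda>v. (q v)\<^sup>2)"
    by (auto simp: square_polys_def)
  obtain c where c: "q = (\<lambda>v. \<Sum>(i, j)\<in>deg_le 1. c i j * fst v ^ i * snd v ^ j)"
    using q by (rule polysE)
  \<comment> \<open>Zero exponents and right nesting are kept so that \<open>polys_add\<close> and
    \<open>monomial_in_polys\<close> apply as introduction rules to the six terms of the expanded
    square.\<close>
  have "r = (\<lambda>v. (c 0 0)\<^sup>2 * fst v ^ 0 * snd v ^ 0
      + (2 * c 0 0 * c 1 0 * fst v ^ 1 * snd v ^ 0 + (2 * c 0 0 * c 0 1 * fst v ^ 0 * snd v ^ 1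
      + ((c 1 0)\<^sup>2 * fst v ^ 2 * snd v ^ 0 + (2 * c 1 0 * c 0 1 * fst v ^ 1 * snd v ^ 1
      + (c 0 1)\<^sup>2 * fst v ^ 0 * snd v ^ 2)))))"
    by (simp add: r c deg_le_1 fun_eq_iff power2_eq_square algebra_simps)
  also have "\<dots> \<in> polys k"
    using assms by (intro polys_add monomial_in_polys) auto
  finally show "r \<in> polys k" .
qed

lemma continuous_on_polys:
  assumes "p \<in> polys k"
  shows "continuous_on A p"
  using assms by (auto elim!: polysE simp: case_prod_unfold intro!: continuous_intros)

section \<open>The functionals evaluated on coefficient sums\<close>

lemma has_integral_monomial_Omega:
  "((\<lambda>v. fst v ^ i * snd v ^ j) has_integral moment i * moment j) Omega"
proof -
  have Om: "Omega = cbox (-1, -1) (1, 1)"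
    by (simp add: Omega_def cbox_Pair_eq)
  have cont: "continuous_on (cbox (-1, -1) (1, 1)) (\<lambda>v::real \<times> real. fst v ^ i * snd v ^ j)"
    by (intro continuous_intros)
  have "integral Omega (\<lambda>v. fst v ^ i * snd v ^ j) = moment i * moment j"
    unfolding Om by (subst integral_prod_continuous [OF cont]) (simp add: moment_def)
  moreover have "(\<lambda>v. fst v ^ i * snd v ^ j :: real) integrable_on Omega"
    unfolding Om by (rule integrable_continuous [OF cont])
  ultimately show ?thesis
    by (simp add: has_integral_integrable_integral)
qed

lemma mean_polys:
  "mean (\<lambda>v. \<Sum>(i, j)\<in>deg_le k. c i j * fst v ^ i * snd v ^ j)
     = (\<Sum>(i, j)\<in>deg_le k. c i j * (moment i * moment j / 4))"
proof -
  have "((\<lambda>v. \<Sum>(i, j)\<in>deg_le k. c i j * (fst v ^ i * snd v ^ j)) has_integral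
      (\<Sum>(i, j)\<in>deg_le k. c i j * (moment i * moment j))) Omega"
    unfolding case_prod_unfold
    by (intro has_integral_sum has_integral_mult_right has_integral_monomial_Omega) simp
  from integral_unique [OF this] show ?thesis
    by (simp add: mean_def case_prod_unfold mult.assoc sum_distrib_left mult_ac sum_divide_distrib)
qed

lemma has_integral_moment: "((\<lambda>x. x ^ i) has_integral moment i) {-1..1}"
  unfolding moment_def by (intro integrable_integral integrable_continuous_real continuous_intros)

text \<open>The edges at -1 and 1 contribute \<open>(-1) ^ i\<close> and 1, so odd powers of the
  first coordinate cancel.\<close>

lemma mean_x_polys:
  "mean_x (\<lambda>v. \<Sum>(i, j)\<in>deg_le k. c i j * fst v ^ i * snd v ^ j)
     = (\<Sum>(i, j)\<in>deg_le k. c i j * (((-1) ^ i + 1) * moment j / 4))"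
proof -
  have "((\<lambda>y. \<Sum>(i, j)\<in>deg_le k. c i j * ((-1) ^ i + 1) * y ^ j) has_integral
      (\<Sum>(i, j)\<in>deg_le k. c i j * ((-1) ^ i + 1) * moment j)) {-1..1}"
    unfolding case_prod_unfold
    by (intro has_integral_sum has_integral_mult_right has_integral_moment) simp
  from integral_unique [OF this] show ?thesis
    by (simp add: mean_x_def case_prod_unfold sum.distrib [symmetric] ring_distribs sum_divide_distrib
          add_divide_distrib mult.assoc)
qed

lemma mean_y_polys:
  "mean_y (\<lambda>v. \<Sum>(i, j)\<in>deg_le k. c i j * fst v ^ i * snd v ^ j)
     = (\<Sum>(i, j)\<in>deg_le k. c i j * (((-1) ^ j + 1) * moment i / 4))"
proof -
  have "((\<lambda>x. \<Sum>(i, j)\<in>deg_le k. c i j * ((-1) ^ j + 1) * x ^ i) has_integral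
      (\<Sum>(i, j)\<in>deg_le k. c i j * ((-1) ^ j + 1) * moment i)) {-1..1}"
    unfolding case_prod_unfold
    by (intro has_integral_sum has_integral_mult_right has_integral_moment) simp
  from integral_unique [OF this] show ?thesis
    by (simp add: mean_y_def case_prod_unfold sum.distrib [symmetric] ring_distribs sum_divide_distrib add_divide_distrib mult_ac)
qed

text \<open>On a monomial the sum over the four reflections factors into one sum per coordinate,
  each zero for an odd exponent.\<close>

lemma sym_avg_polys:
  "sym_avg (\<lambda>v. \<Sum>(i, j)\<in>deg_le k. c i j * fst v ^ i * snd v ^ j) (a, b)
     = (\<Sum>(i, j)\<in>deg_le k. c i j * ((a ^ i + (-a) ^ i) * (b ^ j + (-b) ^ j) / 4))"
  by (simp add: sym_avg_def case_prod_unfold sum.distrib [symmetric] sum_divide_distrib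
        ring_distribs add_divide_distrib mult_ac add_ac)

section \<open>Feasibility of the formula with one node\<close>

lemma cad_identity_from_monomials:
  assumes p: "p \<in> polys k"
    and mono: "\<And>i j. i + j \<le> k \<Longrightarrow> moment i * moment j / 4
      = wb * ((1 + \<theta>) * (((-1) ^ i + 1) * moment j / 4) + (1 - \<theta>) * (((-1) ^ j + 1) * moment i / 4))
        + w * ((a ^ i + (-a) ^ i) * (b ^ j + (-b) ^ j) / 4)"
  shows "mean p = wb * boundary_mean \<theta> p + w * sym_avg p (a, b)"
proof -
  obtain c where c: "p = (\<lambda>v. \<Sum>(i, j)\<in>deg_le k. c i j * fst v ^ i * snd v ^ j)"
    using p by (rule polysE)
  have "mean p = (\<Sum>(i, j)\<in>deg_le k. c i j * (moment i * moment j / 4))"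
    by (simp only: c mean_polys)
  also have "\<dots> = (\<Sum>(i, j)\<in>deg_le k.
      wb * ((1 + \<theta>) * (c i j * (((-1) ^ i + 1) * moment j / 4))
            + (1 - \<theta>) * (c i j * (((-1) ^ j + 1) * moment i / 4)))
      + w * (c i j * ((a ^ i + (-a) ^ i) * (b ^ j + (-b) ^ j) / 4)))"
  proof (rule sum.cong [OF refl], clarify)
    \<comment> \<open>The coefficient is moved onto the individual functionals and no further: in
      this shape the sums regroup into \<open>mean_x\<close>, \<open>mean_y\<close> and
      \<open>sym_avg\<close>.\<close>
    have distrib: "c * (wb * ((1 + \<theta>) * X + (1 - \<theta>) * Y) + w * Z)
        = wb * ((1 + \<theta>) * (c * X) + (1 - \<theta>) * (c * Y)) + w * (c * Z)" for c X Y Z :: real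
      by (simp add: algebra_simps)
    fix i j assume "(i, j) \<in> deg_le k"
    then have "i + j \<le> k"
      by (simp add: deg_le_def)
    then show "c i j * (moment i * moment j / 4)
      = wb * ((1 + \<theta>) * (c i j * (((-1) ^ i + 1) * moment j / 4))
            + (1 - \<theta>) * (c i j * (((-1) ^ j + 1) * moment i / 4)))
      + w * (c i j * ((a ^ i + (-a) ^ i) * (b ^ j + (-b) ^ j) / 4))"
      by (simp only: mono distrib)
  qed
  also have "\<dots> = wb * boundary_mean \<theta> p + w * sym_avg p (a, b)"
    unfolding boundary_mean_def c mean_x_polys mean_y_polys sym_avg_polys
    by (simp only: case_prod_unfold sum.distrib sum_distrib_left [symmetric])
  finally show ?thesis .
qed

lemma sum_le_3_cases:
  fixes i j :: nat
  assumes "i + j \<le> 3"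
  shows "(i, j) \<in> {(0, 0), (0, 1), (0, 2), (0, 3), (1, 0), (1, 1), (1, 2), (2, 0), (2, 1), (3, 0)}"
proof -
  have "i \<le> 3" and "j \<le> 3"
    using assms by simp_all
  then have "i = 0 \<or> i = 1 \<or> i = 2 \<or> i = 3" and "j = 0 \<or> j = 1 \<or> j = 2 \<or> j = 3"
    by (auto simp: numeral_eq_Suc le_Suc_eq)
  with assms show ?thesis
    by (elim disjE) simp_all
qed

text \<open>The two hypotheses on \<open>a\<^sup>2\<close> and \<open>b\<^sup>2\<close> merge the cases \<open>\<theta> \<le> 0\<close> (where \<open>b = 0\<close>) and
  \<open>\<theta> \<ge> 0\<close> (where \<open>a = 0\<close>).\<close>

lemma feasible_cad:
  fixes \<theta> a b :: real
  assumes "k \<le> 3" and ab: "a \<in> {0..1}" "b \<in> {0..1}"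
    and a2: "a\<^sup>2 = (\<bar>\<theta>\<bar> - \<theta>) / (3 + 3 * \<bar>\<theta>\<bar>)" and b2: "b\<^sup>2 = (\<bar>\<theta>\<bar> + \<theta>) / (3 + 3 * \<bar>\<theta>\<bar>)"
  shows "feasible_symmetric_cad \<theta> k (1 / (4 + 2 * \<bar>\<theta>\<bar>)) 1 (\<lambda>_. (1 + \<bar>\<theta>\<bar>) / (2 + \<bar>\<theta>\<bar>)) (\<lambda>_. (a, b))"
proof -
  have pos: "0 < 4 + 2 * \<bar>\<theta>\<bar>" "0 < 2 + \<bar>\<theta>\<bar>" "0 < 1 + \<bar>\<theta>\<bar>" "0 < 3 + 3 * \<bar>\<theta>\<bar>"
    by linarith+
  have "mean p = 1 / (4 + 2 * \<bar>\<theta>\<bar>) * boundary_mean \<theta> p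
      + (1 + \<bar>\<theta>\<bar>) / (2 + \<bar>\<theta>\<bar>) * sym_avg p (a, b)" if "p \<in> polys k" for p
  proof (rule cad_identity_from_monomials [OF that])
    fix i j :: nat assume "i + j \<le> k"
    with assms have "i + j \<le> 3" by simp
    \<comment> \<open>An odd exponent makes every term vanish. This covers all monomials of degree
      3, so the same data serve \<open>k = 2\<close> and \<open>k = 3\<close>. Given the boundary
      weight, \<open>(0, 0)\<close> fixes the node weight, \<open>(2, 0)\<close> then fixes
      \<open>a\<^sup>2\<close>, and \<open>(0, 2)\<close> fixes \<open>b\<^sup>2\<close>.\<close>
    from sum_le_3_cases [OF this] show "moment i * moment j / 4
      = 1 / (4 + 2 * \<bar>\<theta>\<bar>) * ((1 + \<theta>) * (((-1) ^ i + 1) * moment j / 4)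
          + (1 - \<theta>) * (((-1) ^ j + 1) * moment i / 4))
        + (1 + \<bar>\<theta>\<bar>) / (2 + \<bar>\<theta>\<bar>) * ((a ^ i + (-a) ^ i) * (b ^ j + (-b) ^ j) / 4)"
      using pos by (auto simp: moment_eq a2 b2 divide_simps) (auto simp: algebra_simps)
  qed
  with ab pos show ?thesis
    by (simp add: feasible_symmetric_cad_def)
qed

section \<open>Boundary weights as lower bounds for the quotients\<close>

lemma sym_avg_nonneg:
  assumes "\<And>v. v \<in> Omega \<Longrightarrow> 0 \<le> p v" and "z \<in> {0..1} \<times> {0..1}"
  shows "0 \<le> sym_avg p z"
  using assms by (auto simp: sym_avg_def Omega_def intro!: add_nonneg_nonneg)

lemma integral_nonneg_of_continuous:
  fixes f :: "real \<Rightarrow> real"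
  assumes "continuous_on {a..b} f" and "\<And>x. x \<in> {a..b} \<Longrightarrow> 0 \<le> f x"
  shows "0 \<le> integral {a..b} f"
  using assms by (intro integral_nonneg integrable_continuous_real)

text \<open>Both \<open>1 + \<theta>\<close> and \<open>1 - \<theta>\<close> are nonnegative on this
  range. The sign is what permits division by the denominator of \<open>phi\<close>.\<close>

lemma boundary_mean_nonneg:
  assumes p: "p \<in> nonneg_polys k" and "\<theta> \<in> {-1..1}"
  shows "0 \<le> boundary_mean \<theta> p"
proof -
  have cont: "continuous_on UNIV p" and nn: "\<And>v. v \<in> Omega \<Longrightarrow> 0 \<le> p v"
    using p by (auto simp: nonneg_polys_def intro: continuous_on_polys)
  note [continuous_intros] = continuous_on_compose2 [OF cont]
  have "0 \<le> mean_x p" "0 \<le> mean_y p"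
    by (auto simp: mean_x_def mean_y_def Omega_def
          intro!: integral_nonneg_of_continuous continuous_intros add_nonneg_nonneg nn)
  with assms(2) show ?thesis
    by (simp add: boundary_mean_def)
qed

lemma cad_boundary_le_mean:
  assumes cad: "feasible_symmetric_cad \<theta> k wb S w z" and p: "p \<in> nonneg_polys k"
  shows "wb * boundary_mean \<theta> p \<le> mean p"
proof -
  have "0 \<le> (\<Sum>s=1..S. w s * sym_avg p (z s))"
    using cad p
    by (intro sum_nonneg mult_nonneg_nonneg sym_avg_nonneg)
       (auto simp: feasible_symmetric_cad_def nonneg_polys_def intro: less_imp_le)
  moreover have "mean p = wb * boundary_mean \<theta> p + (\<Sum>s=1..S. w s * sym_avg p (z s))"
    using cad p by (simp add: feasible_symmetric_cad_def nonneg_polys_def)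
  ultimately show ?thesis by linarith
qed

text \<open>Weak duality between feasible weights and nonnegative polynomials. A vanishing
  denominator makes \<open>phi\<close> infinite, so only the positive case needs division.\<close>

lemma cad_weight_le_phi:
  assumes cad: "feasible_symmetric_cad \<theta> k wb S w z" and p: "p \<in> nonneg_polys k"
    and "\<theta> \<in> {-1..1}"
  shows "ereal wb \<le> phi \<theta> p"
  using cad_boundary_le_mean [OF cad p] boundary_mean_nonneg [OF p assms(3)]
  by (auto simp: phi_def pos_le_divide_eq)

section \<open>Extremal squares and conclusion\<close>

lemma mean_square_coordinates:
  "mean (\<lambda>v. (fst v)\<^sup>2) = 1 / 3" "mean (\<lambda>v. (snd v)\<^sup>2) = 1 / 3"
  using integral_unique [OF has_integral_monomial_Omega [of 2 0]]
    integral_unique [OF has_integral_monomial_Omega [of 0 2]]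
  by (simp_all add: mean_def moment_eq)

lemma boundary_mean_square_coordinates:
  "boundary_mean \<theta> (\<lambda>v. (fst v)\<^sup>2) = (4 + 2 * \<theta>) / 3"
  "boundary_mean \<theta> (\<lambda>v. (snd v)\<^sup>2) = (4 - 2 * \<theta>) / 3"
proof -
  have "integral {-1..1} (\<lambda>x::real. x\<^sup>2 + x\<^sup>2) = 2 * moment 2"
    by (simp add: moment_def mult_2 [symmetric])
  then show "boundary_mean \<theta> (\<lambda>v. (fst v)\<^sup>2) = (4 + 2 * \<theta>) / 3"
    "boundary_mean \<theta> (\<lambda>v. (snd v)\<^sup>2) = (4 - 2 * \<theta>) / 3"
    by (simp_all add: boundary_mean_def mean_x_def mean_y_def moment_eq field_simps)
qed

text \<open>The squared coordinates have quotients \<open>1 / (4 + 2 * \<theta>)\<close> and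
  \<open>1 / (4 - 2 * \<theta>)\<close>; the sign of \<theta> tells which one is the
  smaller.\<close>

lemma ex_extremal_square:
  assumes "\<theta> \<in> {-1..1}"
  shows "\<exists>q\<in>polys 1 - {\<lambda>_. 0}. phi \<theta> (\<lambda>v. (q v)\<^sup>2) = ereal (1 / (4 + 2 * \<bar>\<theta>\<bar>))"
proof (cases "0 \<le> \<theta>")
  case True
  have "fst \<in> polys 1"
    using monomial_in_polys [of 1 0 1 1] by simp
  moreover have "fst \<noteq> (\<lambda>_::real \<times> real. 0::real)"
    by (metis fst_conv zero_neq_one)
  ultimately show ?thesis
    using True by (intro bexI [of _ fst])
      (auto simp: phi_def mean_square_coordinates boundary_mean_square_coordinates)
next
  case False
  have "snd \<in> polys 1"
    using monomial_in_polys [of 0 1 1 1] by simp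
  moreover have "snd \<noteq> (\<lambda>_::real \<times> real. 0::real)"
    by (metis snd_conv zero_neq_one)
  ultimately show ?thesis
    using False assms by (intro bexI [of _ snd])
      (auto simp: phi_def mean_square_coordinates boundary_mean_square_coordinates)
qed

theorem theorem5p13:
  fixes \<theta> :: real and k :: nat
  assumes "\<theta> \<in> {-1..1}" and "k \<in> {2, 3}"
  shows "(\<theta> \<in> {-1..0} \<longrightarrow>
            symmetric_ocad \<theta> k (1 / (4 + 2 * \<bar>\<theta>\<bar>)) 1 (\<lambda>_. (1 + \<bar>\<theta>\<bar>) / (2 + \<bar>\<theta>\<bar>))
              (\<lambda>_. (sqrt (2 * \<bar>\<theta>\<bar> / (3 + 3 * \<bar>\<theta>\<bar>)), 0))) \<and>
         (\<theta> \<in> {0..1} \<longrightarrow>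
            symmetric_ocad \<theta> k (1 / (4 + 2 * \<bar>\<theta>\<bar>)) 1 (\<lambda>_. (1 + \<bar>\<theta>\<bar>) / (2 + \<bar>\<theta>\<bar>))
              (\<lambda>_. (0, sqrt (2 * \<bar>\<theta>\<bar> / (3 + 3 * \<bar>\<theta>\<bar>))))) \<and>
         omega_star \<theta> k = 1 / (4 + 2 * \<bar>\<theta>\<bar>) \<and>
         ereal (omega_star \<theta> k) = phi_star \<theta> (nonneg_polys k) \<and>
         phi_star \<theta> (nonneg_polys k) = phi_star \<theta> (square_polys 1) \<and>
         phi_star \<theta> (square_polys 1) = ereal (1 / (4 + 2 * \<bar>\<theta>\<bar>)) \<and>
         (\<exists>q\<in>polys 1 - {\<lambda>_. 0}. critical_positive_poly \<theta> k (\<lambda>v. (q v)\<^sup>2))"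
proof -
  let ?wb = "1 / (4 + 2 * \<bar>\<theta>\<bar>)"
  let ?s = "sqrt (2 * \<bar>\<theta>\<bar> / (3 + 3 * \<bar>\<theta>\<bar>))"
  have k: "2 \<le> k" "k \<le> 3" using assms(2) by auto
  have s: "?s \<in> {0..1}" and s2: "?s\<^sup>2 = 2 * \<bar>\<theta>\<bar> / (3 + 3 * \<bar>\<theta>\<bar>)"
    using assms(1) by (auto simp: divide_simps)
  \<comment> \<open>Here \<open>\<bar>\<theta>\<bar> - \<theta> = 2 * \<bar>\<theta>\<bar>\<close>
    and \<open>\<bar>\<theta>\<bar> + \<theta> = 0\<close>, as \<open>feasible_cad\<close> requires;
    the other sign exchanges the coordinates.\<close>
  have cad_nonpos: "feasible_symmetric_cad \<theta> k ?wb 1 (\<lambda>_. (1 + \<bar>\<theta>\<bar>) / (2 + \<bar>\<theta>\<bar>)) (\<lambda>_. (?s, 0))"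
    if "\<theta> \<in> {-1..0}"
    using that s s2 by (intro feasible_cad k(2)) auto
  have cad_nonneg: "feasible_symmetric_cad \<theta> k ?wb 1 (\<lambda>_. (1 + \<bar>\<theta>\<bar>) / (2 + \<bar>\<theta>\<bar>)) (\<lambda>_. (0, ?s))"
    if "\<theta> \<in> {0..1}"
    using that s s2 by (intro feasible_cad k(2)) auto
  obtain q where q: "q \<in> polys 1" "q \<noteq> (\<lambda>_. 0)" and phi_q: "phi \<theta> (\<lambda>v. (q v)\<^sup>2) = ereal ?wb"
    using ex_extremal_square [OF assms(1)] by auto
  have sub: "square_polys 1 \<subseteq> nonneg_polys k"
    using square_polys_1_subset [OF k(1)] by (auto simp: nonneg_polys_def square_polys_def)
  have q2: "(\<lambda>v. (q v)\<^sup>2) \<in> square_polys 1"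
    using q(1) by (auto simp: square_polys_def)
  have le: "wb' \<le> ?wb" if "feasible_symmetric_cad \<theta> k wb' S w z" for wb' S w z
    using cad_weight_le_phi [OF that _ assms(1)] q2 sub phi_q
    by (metis ereal_less_eq(3) subsetD)
  have ocad_neg: "symmetric_ocad \<theta> k ?wb 1 (\<lambda>_. (1 + \<bar>\<theta>\<bar>) / (2 + \<bar>\<theta>\<bar>)) (\<lambda>_. (?s, 0))"
    if "\<theta> \<in> {-1..0}"
    using cad_nonpos [OF that] le by (auto simp: symmetric_ocad_def)
  have ocad_pos: "symmetric_ocad \<theta> k ?wb 1 (\<lambda>_. (1 + \<bar>\<theta>\<bar>) / (2 + \<bar>\<theta>\<bar>)) (\<lambda>_. (0, ?s))"
    if "\<theta> \<in> {0..1}"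
    using cad_nonneg [OF that] le by (auto simp: symmetric_ocad_def)
  \<comment> \<open>Only the existence of a formula with weight \<open>?wb\<close> matters from here
    on, so the two signs are merged.\<close>
  obtain S w z where cad: "feasible_symmetric_cad \<theta> k ?wb S w z"
    using cad_nonpos cad_nonneg assms(1)
    by (metis atLeastAtMost_iff linear)
  have omega: "omega_star \<theta> k = ?wb"
    unfolding omega_star_def using cad le by (intro Greatest_equality) blast+
  \<comment> \<open>Stated for every intermediate set, so that \<open>square_polys 1\<close> and
    \<open>nonneg_polys k\<close> are both instances: the square of \<open>q\<close> gives the upper
    bound, the formula just obtained the lower one.\<close>
  have phi_star: "phi_star \<theta> A = ereal ?wb" if "square_polys 1 \<subseteq> A" "A \<subseteq> nonneg_polys k" for A
    unfolding phi_star_def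
  proof (rule antisym)
    show "(INF p\<in>A. phi \<theta> p) \<le> ereal ?wb"
      using q2 that(1) by (metis INF_lower phi_q subsetD)
    show "ereal ?wb \<le> (INF p\<in>A. phi \<theta> p)"
      using cad_weight_le_phi [OF cad _ assms(1)] that(2) by (intro INF_greatest) blast
  qed
  have "critical_positive_poly \<theta> k (\<lambda>v. (q v)\<^sup>2)"
    using q q2 sub phi_q phi_star [OF sub] by (auto simp: critical_positive_poly_def fun_eq_iff)
  with q ocad_neg ocad_pos omega phi_star [OF sub] phi_star [OF _ sub] show ?thesis
    by auto
qed

end
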